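(* The merit function $\Pi:\mathbb R^n\times\mathbb R^r\to\mathbb R\cup\{+\infty\}$ defined by $$\Pi(x,\xi):=\sup_{z\in\Omega,\ \zeta\in\mathbb R^r}\ \min_{1\le j\le m}\big[Q_j(x,\zeta)-Q_j(z,\xi)\big],\qquad Q_j(x,\xi):=f_j(x)+\langle\xi,Ax-b\rangle,$$ is nonnegative and lower semicontinuous. Moreover, a point $x^*\in\mathbb R^n$ is weakly Pareto optimal for the problem of minimizing $F$ over $\Omega$ if and only if there exists $\xi^*\in\mathbb R^r$ such that $\Pi(x^*,\xi^* )=0$.
   Context: Let $m,n,r\ge 1$, $A\in\mathbb R^{r\times n}$, $b\in\mathbb R^r$, and assume $\Omega:=\{x\in\mathbb R^n: Ax=b\}\neq\emptyset$. For $1\le j\le m$ let $f_j:\mathbb R^n\to\mathbb R$ be a $C^1$ function whose gradient is $L_j$-Lipschitz and which satisfies $f_j(y)-f_j(x)-\langle\nabla f_j(x),y-x\rangle\ge\frac{\mu_j}{2}\|x-y\|^2$ for all $x,y$, where $0\le\mu_j\le L_j<\infty$. Put $F:=(f_1,\dots,f_m)^\top$. A point $x^*$ is weakly Pareto optimal if $x^*\in\Omega$ and there is no $x\in\Omega$ with $f_j(x)<f_j(x^* )$ for all $j$. *)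

theory Defs
  imports "HOL-Analysis.Analysis"
begin

text \<open>
  The dimensions \<open>m\<close>, \<open>n\<close>, \<open>r\<close> are the cardinalities of the finite index types
  \<open>'m\<close>, \<open>'n\<close>, \<open>'r\<close>. These are nonempty, so \<open>m, n, r \<ge> 1\<close> holds automatically.
\<close>

definition feasible :: "real ^ 'n ^ 'r \<Rightarrow> real ^ 'r \<Rightarrow> (real ^ 'n) set" where
  "feasible A b = {x. A *v x = b}"

definition weakly_pareto_optimal :: "('a \<Rightarrow> real ^ 'm) \<Rightarrow> 'a set \<Rightarrow> 'a \<Rightarrow> bool" where
  "weakly_pareto_optimal F \<Omega> x \<longleftrightarrow>
     x \<in> \<Omega> \<and> \<not> (\<exists>y\<in>\<Omega>. \<forall>j. F y $ j < F x $ j)"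

definition lagrangian ::
  "('m \<Rightarrow> real ^ 'n \<Rightarrow> real) \<Rightarrow> real ^ 'n ^ 'r \<Rightarrow> real ^ 'r \<Rightarrow>
   'm \<Rightarrow> real ^ 'n \<Rightarrow> real ^ 'r \<Rightarrow> real" where
  "lagrangian f A b j x \<xi> = f j x + \<xi> \<bullet> (A *v x - b)"

text \<open>
  The supremum is taken in the extended reals, where an unbounded family has supremum \<open>\<infinity>\<close>.
  Note that the multipliers are exchanged: \<open>\<zeta>\<close> goes with \<open>x\<close> and \<open>\<xi>\<close> with \<open>z\<close>.
\<close>

definition merit ::
  "('m::finite \<Rightarrow> real ^ 'n \<Rightarrow> real) \<Rightarrow> real ^ 'n ^ 'r \<Rightarrow> real ^ 'r \<Rightarrow>
   real ^ 'n \<Rightarrow> real ^ 'r \<Rightarrow> ereal" where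
  "merit f A b x \<xi> =
     (SUP (z, \<zeta>) \<in> feasible A b \<times> UNIV.
        ereal (MIN j. lagrangian f A b j x \<zeta> - lagrangian f A b j z \<xi>))"

text \<open>
  The filter \<open>at x\<close> is punctured, but this does not matter: including \<open>x\<close> itself in the
  lower limit gives the same inequality.
\<close>

definition lower_semicontinuous :: "('a::topological_space \<Rightarrow> ereal) \<Rightarrow> bool" where
  "lower_semicontinuous f \<longleftrightarrow> (\<forall>x. f x \<le> Liminf (at x) f)"

end

theory Submission
  imports Defs
begin

text \<open>
  On the feasible set the term \<open>\<xi> \<bullet> (A z - b)\<close> vanishes, so the merit function does not depend
  on \<open>\<xi>\<close> and is a supremum of functions that are continuous in \<open>x\<close>. At an infeasible \<open>x\<close> the
  multiplier \<open>\<zeta>\<close> in the direction of the residual \<open>A x - b\<close> makes it positive; at a feasible \<open>x\<close>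
  it is the supremum of \<open>min\<^sub>j (f\<^sub>j x - f\<^sub>j z)\<close>, which vanishes exactly when no \<open>z\<close> improves
  all objectives strictly.
\<close>

lemma continuous_on_Min_range:
  fixes g :: "'m::finite \<Rightarrow> 'a::topological_space \<Rightarrow> 'b::linorder_topology"
  assumes "\<And>j. continuous_on S (g j)"
  shows "continuous_on S (\<lambda>x. MIN j. g j x)"
proof -
  \<comment> \<open>Replacing the full index type by an arbitrary nonempty finite \<open>J\<close>
    makes induction possible, one binary minimum at a time.\<close>
  have "continuous_on S (\<lambda>x. Min ((\<lambda>j. g j x) ` J))" if "finite J" "J \<noteq> {}" for J
    using that
  proof (induction J rule: finite_ne_induct)
    case (singleton j)
    then show ?case using assms by simp
  next
    case (insert j J)
    then show ?case using assms by (simp add: continuous_on_min)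
  qed
  then show ?thesis by simp
qed

text \<open>Each \<open>g i\<close> lies below the supremum, so its lower limit at \<open>x\<close>
  is at most that of the supremum; this bounds every \<open>g i x\<close>.\<close>

lemma lower_semicontinuous_SUP:
  assumes "\<And>i. i \<in> I \<Longrightarrow> lower_semicontinuous (g i)"
  shows "lower_semicontinuous (\<lambda>x. SUP i\<in>I. g i x)"
  unfolding lower_semicontinuous_def
proof
  fix x
  show "(SUP i\<in>I. g i x) \<le> Liminf (at x) (\<lambda>x. SUP i\<in>I. g i x)"
  proof (rule SUP_least)
    fix i assume i: "i \<in> I"
    have "g i x \<le> Liminf (at x) (g i)"
      using assms[OF i] unfolding lower_semicontinuous_def by blast
    also have "\<dots> \<le> Liminf (at x) (\<lambda>x. SUP i\<in>I. g i x)"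
      using i by (intro Liminf_mono always_eventually allI SUP_upper)
    finally show "g i x \<le> Liminf (at x) (\<lambda>x. SUP i\<in>I. g i x)" .
  qed
qed

lemma lower_semicontinuous_continuous:
  assumes "continuous_on UNIV g"
  shows "lower_semicontinuous g"
  unfolding lower_semicontinuous_def le_Liminf_iff
proof (intro allI impI)
  fix x y assume "y < g x"
  moreover have "(g \<longlongrightarrow> g x) (at x)"
    using assms by (simp add: continuous_on_def)
  ultimately show "\<forall>\<^sub>F x in at x. y < g x"
    by (simp add: order_tendstoD)
qed

lemma GDERIV_imp_continuous_on:
  assumes "\<And>x. GDERIV f x :> grad x"
  shows "continuous_on S f"
  using assms unfolding gderiv_def
  by (meson has_derivative_continuous continuous_at_imp_continuous_on)

lemma lagrangian_feasible:
  "z \<in> feasible A b \<Longrightarrow> lagrangian f A b j z \<xi> = f j z"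
  by (simp add: lagrangian_def feasible_def)

text \<open>One pair \<open>(z, \<zeta>)\<close> bounds the supremum from below. It is applied with
  \<open>\<zeta> = 0\<close> at feasible points and with a multiple of the residual
  elsewhere.\<close>

lemma merit_ge:
  fixes f :: "'m::finite \<Rightarrow> real ^ 'n \<Rightarrow> real"
  assumes "z \<in> feasible A b" "\<And>j. c \<le> lagrangian f A b j x \<zeta> - f j z"
  shows "ereal c \<le> merit f A b x \<xi>"
proof -
  have "c \<le> (MIN j. lagrangian f A b j x \<zeta> - lagrangian f A b j z \<xi>)"
    using assms by (simp add: lagrangian_feasible)
  then show ?thesis
    unfolding merit_def using assms(1)
    by (intro SUP_upper2[where i = "(z, \<zeta>)"]) auto
qed

lemma merit_infeasible_pos:
  fixes f :: "'m::finite \<Rightarrow> real ^ 'n \<Rightarrow> real"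
  assumes "feasible A b \<noteq> {}" "x \<notin> feasible A b"
  shows "0 < merit f A b x \<xi>"
proof -
  obtain z where z: "z \<in> feasible A b"
    using assms(1) by blast
  define d where "d = A *v x - b"
  define c where "c = (MIN j. f j x - f j z)"
  \<comment> \<open>The multiplier \<open>t *\<^sub>R d\<close> adds \<open>1 - c\<close> to all
    objectives alike, which lifts even the smallest difference \<open>c\<close> to 1.\<close>
  define t where "t = (1 - c) / (d \<bullet> d)"
  have "d \<bullet> d \<noteq> 0"
    using assms(2) by (simp add: d_def feasible_def)
  then have td: "t *\<^sub>R d \<bullet> d = 1 - c"
    by (simp add: t_def)
  have "1 \<le> lagrangian f A b j x (t *\<^sub>R d) - f j z" for j
  proof -
    have "c \<le> f j x - f j z"
      unfolding c_def by (rule Min_le) auto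
    with td show ?thesis
      by (simp add: lagrangian_def flip: d_def)
  qed
  from merit_ge[OF z this] have "1 \<le> merit f A b x \<xi>"
    by (simp add: one_ereal_def)
  then show ?thesis
    by (rule less_le_trans[rotated]) simp
qed

lemma merit_nonneg:
  fixes f :: "'m::finite \<Rightarrow> real ^ 'n \<Rightarrow> real"
  assumes "feasible A b \<noteq> {}"
  shows "0 \<le> merit f A b x \<xi>"
proof (cases "x \<in> feasible A b")
  case True
  then have "ereal 0 \<le> merit f A b x \<xi>"
    \<comment> \<open>Comparing \<open>x\<close> with itself makes every difference zero.\<close>
    by (intro merit_ge[where z = x and \<zeta> = 0]) (simp_all add: lagrangian_feasible)
  then show ?thesis by (simp add: zero_ereal_def)
next
  case False
  then show ?thesis using merit_infeasible_pos[OF assms] by (intro less_imp_le)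
qed

lemma lower_semicontinuous_merit:
  fixes f :: "'m::finite \<Rightarrow> real ^ 'n \<Rightarrow> real"
  assumes "\<And>j. continuous_on UNIV (f j)"
  shows "lower_semicontinuous (\<lambda>(x, \<xi>). merit f A b x \<xi>)"
proof -
  have f: "continuous_on UNIV (\<lambda>p :: (real ^ 'n) \<times> (real ^ 'r). f j (fst p))" for j
    using continuous_on_compose2[OF assms continuous_on_fst[OF continuous_on_id]] by simp
  have A: "continuous_on UNIV (\<lambda>p :: (real ^ 'n) \<times> (real ^ 'r). A *v fst p)"
    by (intro bounded_linear.continuous_on[OF matrix_vector_mul_bounded_linear] continuous_intros)
  \<comment> \<open>For fixed \<open>(z, \<zeta>)\<close> the term is jointly continuous in
    \<open>p\<close>: the multiplier in \<open>snd p\<close> enters affinely.\<close>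
  have "lower_semicontinuous (\<lambda>p. SUP (z, \<zeta>) \<in> feasible A b \<times> UNIV.
      ereal (MIN j. lagrangian f A b j (fst p) \<zeta> - lagrangian f A b j z (snd p)))"
    unfolding case_prod_beta lagrangian_def
    by (intro lower_semicontinuous_SUP lower_semicontinuous_continuous continuous_on_ereal
        continuous_on_Min_range continuous_intros f A)
  then show ?thesis
    by (simp add: merit_def case_prod_beta')
qed

lemma merit_eq_0_iff:
  fixes f :: "'m::finite \<Rightarrow> real ^ 'n \<Rightarrow> real"
  assumes "feasible A b \<noteq> {}"
  shows "merit f A b x \<xi> = 0 \<longleftrightarrow>
    weakly_pareto_optimal (\<lambda>y. \<chi> j. f j y) (feasible A b) x"
proof (cases "x \<in> feasible A b")
  case True
  \<comment> \<open>An upper bound on a supremum can be tested member by member, unlike an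
    equality.\<close>
  have "merit f A b x \<xi> = 0 \<longleftrightarrow> merit f A b x \<xi> \<le> 0"
    using merit_nonneg[OF assms, of f x \<xi>] by auto
  also have "\<dots> \<longleftrightarrow> (\<forall>z\<in>feasible A b. (MIN j. f j x - f j z) \<le> 0)"
    using True by (simp add: merit_def SUP_le_iff lagrangian_feasible cong: image_cong_simp)
  also have "\<dots> \<longleftrightarrow> (\<forall>z\<in>feasible A b. \<exists>j. f j x \<le> f j z)"
    by (simp add: Min_le_iff)
  finally show ?thesis
    using True by (auto simp: weakly_pareto_optimal_def not_less)
next
  case False
  then show ?thesis
    using merit_infeasible_pos[OF assms False, of f \<xi>]
    by (auto simp: weakly_pareto_optimal_def)
qed

theorem lemma2p2:
  fixes A :: "real ^ 'n ^ 'r" and b :: "real ^ 'r"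
    and f :: "'m::finite \<Rightarrow> real ^ 'n \<Rightarrow> real"
    and grad :: "'m \<Rightarrow> real ^ 'n \<Rightarrow> real ^ 'n"
    and L \<mu> :: "'m \<Rightarrow> real"
  assumes "feasible A b \<noteq> {}"
    and "\<And>j x. GDERIV (f j) x :> grad j x"
    and "\<And>j. continuous_on UNIV (grad j)"
    and "\<And>j. (L j)-lipschitz_on UNIV (grad j)"
    and "\<And>j. 0 \<le> \<mu> j" and "\<And>j. \<mu> j \<le> L j"
    and "\<And>j x y. f j y - f j x - grad j x \<bullet> (y - x) \<ge> \<mu> j / 2 * (norm (x - y))\<^sup>2"
  shows "(\<forall>x \<xi>. 0 \<le> merit f A b x \<xi>)
    \<and> lower_semicontinuous (\<lambda>(x, \<xi>). merit f A b x \<xi>)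
    \<and> (\<forall>x. weakly_pareto_optimal (\<lambda>y. \<chi> j. f j y) (feasible A b) x
         \<longleftrightarrow> (\<exists>\<xi>. merit f A b x \<xi> = 0))"
  \<comment> \<open>By \<open>merit_eq_0_iff\<close> the condition under the existential is the same
    for every \<open>\<xi>\<close>, so the quantifier disappears.\<close>
  by (simp add: merit_nonneg merit_eq_0_iff assms(1)
      lower_semicontinuous_merit[OF GDERIV_imp_continuous_on[OF assms(2)]])

end
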